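(* The finite-terminating generalized mountain climbing algorithm (described in the context), started from any $x_0\in\mathcal F$, always terminates in finitely many steps.
   Context: Setting: $Q$ is a real symmetric $n\times n$ matrix with at least one negative eigenvalue, $d\in\mathbb R^n$, $A\in\mathbb R^{m\times n}$ with rows $a_i^\top$, $b\in\mathbb R^m$, and $\mathcal F=\{x\in\mathbb R^n:Ax\le b\}$ is bounded. $\Phi(x)=x^\top Qx+2d^\top x$. For $I\subset[m]=\{1,\dots,m\}$: $\mathcal H_I=\{x:A_Ix=0\}$ and $\hat{\mathcal H}_I=\{x:A_Ix=b_I\}$, where $A_I,b_I$ are the rows/entries indexed by $I$ (and $\mathcal H_\emptyset=\hat{\mathcal H}_\emptyset=\mathbb R^n$). For $x\in\mathcal F$, $I_x=\{i\in[m]:a_i^\top x=b_i\}$. $Q|_{\mathcal H}\succ0$ means $p^\top Qp>0$ for all nonzero $p\in\mathcal H$ (automatically true if $\mathcal H=\{\mathbf 0\}$). Fix symmetric positive semidefinite matrices $M,N$ with $Q=M-N$ and set $$\Psi(x,\tilde x)=\tfrac12x^\top Mx+\tfrac12\tilde x^\top M\tilde x+d^\top x+d^\top\tilde x-x^\top N\tilde x.$$ Algorithm (all subproblems are solved exactly; any choice satisfying the stated requirement may be made). Input $x_0\in\mathcal F$; set $k=0$. Repeat the following iteration: 1. Set $\hat x=x_k$. 2. If $Q|_{\mathcal H_{I_{\hat x}}}\succ0$: choose $\tilde x\in\operatorname{argmin}\{\Phi(x):x\in\mathcal F\cap\hat{\mathcal H}_{I_{\hat x}}\}$, then choose $\bar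 x\in\operatorname{argmin}\{\Psi(x,\tilde x):x\in\mathcal F\}$. If $\Phi(\bar x)\ge\Phi(\tilde x)$, set $\bar x:=\tilde x$ and stop, with output $\bar x$. 3. Otherwise (i.e. $Q|_{\mathcal H_{I_{\hat x}}}\succ0$ fails): choose $\bar x\in\mathcal F$ such that $\Phi(\bar x)\le\Phi(\hat x)$ and $I_{\hat x}\subsetneq I_{\bar x}$ (such a point always exists). 4. Set $x_{k+1}=\bar x$ and $k:=k+1$. "Terminates in finitely many steps" means that the stopping condition in step 2 is met after finitely many iterations. *)

theory Defs
  imports "HOL-Analysis.Analysis"
begin

definition eigenvalue :: "real^'n^'n \<Rightarrow> real \<Rightarrow> bool" where
  "eigenvalue Q l \<longleftrightarrow> (\<exists>v. v \<noteq> 0 \<and> Q *v v = l *\<^sub>R v)"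

definition symmetric_psd :: "real^'n^'n \<Rightarrow> bool" where
  "symmetric_psd M \<longleftrightarrow> transpose M = M \<and> (\<forall>x. 0 \<le> x \<bullet> (M *v x))"

definition positive_definite_on :: "real^'n^'n \<Rightarrow> (real^'n) set \<Rightarrow> bool" where
  "positive_definite_on Q H \<longleftrightarrow> (\<forall>p\<in>H. p \<noteq> 0 \<longrightarrow> 0 < p \<bullet> (Q *v p))"

definition feasible :: "real^'n^'m \<Rightarrow> real^'m \<Rightarrow> (real^'n) set" where
  "feasible A b = {x. A *v x \<le> b}"

definition Phi :: "real^'n^'n \<Rightarrow> real^'n \<Rightarrow> real^'n \<Rightarrow> real" where
  "Phi Q d x = x \<bullet> (Q *v x) + 2 * (d \<bullet> x)"

definition Psi :: "real^'n^'n \<Rightarrow> real^'n^'n \<Rightarrow> real^'n \<Rightarrow> real^'n \<Rightarrow> real^'n \<Rightarrow> real" where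
  "Psi M N d x xt =
     1/2 * (x \<bullet> (M *v x)) + 1/2 * (xt \<bullet> (M *v xt)) + d \<bullet> x + d \<bullet> xt - x \<bullet> (N *v xt)"

definition lin_sub :: "real^'n^'m \<Rightarrow> 'm set \<Rightarrow> (real^'n) set" where
  "lin_sub A I = {x. \<forall>i\<in>I. (A *v x) $ i = 0}"

definition aff_sub :: "real^'n^'m \<Rightarrow> real^'m \<Rightarrow> 'm set \<Rightarrow> (real^'n) set" where
  "aff_sub A b I = {x. \<forall>i\<in>I. (A *v x) $ i = b $ i}"

definition active :: "real^'n^'m \<Rightarrow> real^'m \<Rightarrow> real^'n \<Rightarrow> 'm set" where
  "active A b x = {i. (A *v x) $ i = b $ i}"

text \<open>The admissible choices in each subproblem: the minimizers of \<open>Phi\<close> on the face of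
  \<open>xh\<close>, the minimizers of \<open>Psi\<close> in its first argument, and the points of no larger objective
  value with strictly more active constraints.\<close>

definition face_minimizers ::
  "real^'n^'n \<Rightarrow> real^'n \<Rightarrow> real^'n^'m \<Rightarrow> real^'m \<Rightarrow> real^'n \<Rightarrow> (real^'n) set" where
  "face_minimizers Q d A b xh =
     {xt. is_arg_min (Phi Q d) (\<lambda>x. x \<in> feasible A b \<inter> aff_sub A b (active A b xh)) xt}"

definition climbing_points ::
  "real^'n^'n \<Rightarrow> real^'n^'n \<Rightarrow> real^'n \<Rightarrow> real^'n^'m \<Rightarrow> real^'m \<Rightarrow> real^'n \<Rightarrow> (real^'n) set" where
  "climbing_points M N d A b xt =
     {xb. is_arg_min (\<lambda>x. Psi M N d x xt) (\<lambda>x. x \<in> feasible A b) xb}"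

definition descent_points ::
  "real^'n^'n \<Rightarrow> real^'n \<Rightarrow> real^'n^'m \<Rightarrow> real^'m \<Rightarrow> real^'n \<Rightarrow> (real^'n) set" where
  "descent_points Q d A b xh =
     {xb \<in> feasible A b. Phi Q d xb \<le> Phi Q d xh \<and> active A b xh \<subset> active A b xb}"

datatype 'v outcome = Continue 'v | Stop 'v

text \<open>\<open>iteration Q M N d A b xh r\<close>: one pass through the loop body from the iterate \<open>xh\<close> can end
  with \<open>r\<close>, which is either the next iterate or the output.\<close>

inductive iteration ::
  "real^'n^'n \<Rightarrow> real^'n^'n \<Rightarrow> real^'n^'n \<Rightarrow> real^'n \<Rightarrow> real^'n^'m \<Rightarrow> real^'m \<Rightarrow>
     real^'n \<Rightarrow> (real^'n) outcome \<Rightarrow> bool"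
  for Q M N :: "real^'n^'n" and d :: "real^'n" and A :: "real^'n^'m" and b :: "real^'m"
where
  stop:
    "\<lbrakk> positive_definite_on Q (lin_sub A (active A b xh));
       xt \<in> face_minimizers Q d A b xh; xb \<in> climbing_points M N d A b xt;
       Phi Q d xb \<ge> Phi Q d xt \<rbrakk> \<Longrightarrow> iteration Q M N d A b xh (Stop xt)"
| climb:
    "\<lbrakk> positive_definite_on Q (lin_sub A (active A b xh));
       xt \<in> face_minimizers Q d A b xh; xb \<in> climbing_points M N d A b xt;
       \<not> Phi Q d xb \<ge> Phi Q d xt \<rbrakk> \<Longrightarrow> iteration Q M N d A b xh (Continue xb)"
| descend:
    "\<lbrakk> \<not> positive_definite_on Q (lin_sub A (active A b xh));
       xb \<in> descent_points Q d A b xh \<rbrakk> \<Longrightarrow> iteration Q M N d A b xh (Continue xb)"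

definition reachable ::
  "real^'n^'n \<Rightarrow> real^'n^'n \<Rightarrow> real^'n^'n \<Rightarrow> real^'n \<Rightarrow> real^'n^'m \<Rightarrow> real^'m \<Rightarrow>
     real^'n \<Rightarrow> real^'n \<Rightarrow> bool" where
  "reachable Q M N d A b = rtranclp (\<lambda>x y. iteration Q M N d A b x (Continue y))"

text \<open>No sequence of choices made within the pass from \<open>xh\<close> leaves a later choice impossible.\<close>

definition never_stuck ::
  "real^'n^'n \<Rightarrow> real^'n^'n \<Rightarrow> real^'n^'n \<Rightarrow> real^'n \<Rightarrow> real^'n^'m \<Rightarrow> real^'m \<Rightarrow>
     real^'n \<Rightarrow> bool" where
  "never_stuck Q M N d A b xh \<longleftrightarrow>
     (if positive_definite_on Q (lin_sub A (active A b xh))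
      then face_minimizers Q d A b xh \<noteq> {} \<and>
           (\<forall>xt \<in> face_minimizers Q d A b xh. climbing_points M N d A b xt \<noteq> {})
      else descent_points Q d A b xh \<noteq> {})"

text \<open>A run as an infinite sequence: \<open>r k\<close> is the situation after \<open>k\<close> iterations, constant once
  the algorithm has stopped.\<close>

definition is_run ::
  "real^'n^'n \<Rightarrow> real^'n^'n \<Rightarrow> real^'n^'n \<Rightarrow> real^'n \<Rightarrow> real^'n^'m \<Rightarrow> real^'m \<Rightarrow>
     real^'n \<Rightarrow> (nat \<Rightarrow> (real^'n) outcome) \<Rightarrow> bool" where
  "is_run Q M N d A b x0 r \<longleftrightarrow>
     r 0 = Continue x0 \<and>
     (\<forall>k. case r k of
            Continue x \<Rightarrow> iteration Q M N d A b x (r (Suc k))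
          | Stop y \<Rightarrow> r (Suc k) = Stop y)"

end

theory Submission
  imports Defs
begin

text \<open>
  A feasible point whose active face carries a direction \<open>p\<close> with \<open>p \<bullet> Q p \<le> 0\<close> admits a
  descent point: orient \<open>p\<close> so that \<open>Phi\<close> does not increase along it and move until a new
  constraint becomes active. Along a run \<open>Phi\<close> never increases, and a climbing step from the
  face of \<open>x\<close> drops \<open>Phi\<close> strictly below its minimum over that face, so no later iterate lies on
  that face and each active set occurs in at most one climbing step. Between climbing steps
  the active set grows strictly, so there are only finitely many steps altogether.
\<close>

section \<open>Existence of minimizers by compactness\<close>

lemma continuous_on_matrix_vector_mult [continuous_intros]:
  fixes A :: "real^'n^'m"
  assumes "continuous_on S f"
  shows "continuous_on S (\<lambda>x. A *v f x)"
  using assms by (rule bounded_linear.continuous_on[OF matrix_vector_mul_bounded_linear])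

lemma feasible_iff: "x \<in> feasible A b \<longleftrightarrow> (\<forall>i. (A *v x) $ i \<le> b $ i)"
  by (simp add: feasible_def less_eq_vec_def)

lemma closed_feasible: "closed (feasible A b)"
  unfolding feasible_def less_eq_vec_def
  by (intro closed_Collect_all closed_Collect_le continuous_intros)

lemma closed_aff_sub: "closed (aff_sub A b I)"
  unfolding aff_sub_def Ball_def
  by (intro closed_Collect_all closed_Collect_imp open_Collect_const closed_Collect_eq
      continuous_intros)

lemma compact_feasible: "bounded (feasible A b) \<Longrightarrow> compact (feasible A b)"
  by (simp add: compact_eq_bounded_closed closed_feasible)

lemma self_in_aff_sub_active: "x \<in> aff_sub A b (active A b x)"
  by (simp add: aff_sub_def active_def)

lemma compact_is_arg_min_exists:
  fixes f :: "'a::topological_space \<Rightarrow> real"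
  assumes "compact S" "S \<noteq> {}" "continuous_on S f"
  shows "\<exists>x. is_arg_min f (\<lambda>x. x \<in> S) x"
  using continuous_attains_inf[OF assms] by (auto simp: is_arg_min_linorder)

lemma face_minimizers_nonempty:
  assumes "bounded (feasible A b)" "x \<in> feasible A b"
  shows "face_minimizers Q d A b x \<noteq> {}"
proof -
  have "compact (feasible A b \<inter> aff_sub A b (active A b x))"
    using assms by (intro compact_Int_closed compact_feasible closed_aff_sub)
  moreover have "continuous_on (feasible A b \<inter> aff_sub A b (active A b x)) (Phi Q d)"
    unfolding Phi_def [abs_def] by (intro continuous_intros)
  ultimately show ?thesis
    unfolding face_minimizers_def
    using compact_is_arg_min_exists assms(2) self_in_aff_sub_active by blast
qed

lemma climbing_points_nonempty:
  assumes "bounded (feasible A b)" "x \<in> feasible A b"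
  shows "climbing_points M N d A b y \<noteq> {}"
proof -
  have "continuous_on (feasible A b) (\<lambda>x. Psi M N d x y)"
    unfolding Psi_def by (intro continuous_intros)
  then show ?thesis
    unfolding climbing_points_def
    using compact_is_arg_min_exists[OF compact_feasible[OF assms(1)]] assms(2) by blast
qed

section \<open>Descent along a line inside the active face\<close>

lemma Phi_along_line:
  "Phi Q d (x + t *\<^sub>R p) =
     Phi Q d x + t * (x \<bullet> (Q *v p) + p \<bullet> (Q *v x) + 2 * (d \<bullet> p)) + t\<^sup>2 * (p \<bullet> (Q *v p))"
  by (simp add: Phi_def matrix_vector_right_distrib matrix_vector_mult_scaleR inner_add_left
      inner_add_right algebra_simps power2_eq_square)

lemma lin_sub_uminus: "p \<in> lin_sub A I \<Longrightarrow> - p \<in> lin_sub A I"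
  using matrix_vector_mult_scaleR[of A "-1" p] by (simp add: lin_sub_def)

lemma matrix_vector_mult_line_nth:
  fixes A :: "real^'n^'m"
  shows "(A *v (x + t *\<^sub>R p)) $ i = (A *v x) $ i + t * (A *v p) $ i"
  by (simp add: matrix_vector_right_distrib matrix_vector_mult_scaleR)

lemma active_mono_along_line:
  assumes "p \<in> lin_sub A (active A b x)"
  shows "active A b x \<subseteq> active A b (x + t *\<^sub>R p)"
  using assms by (auto simp: active_def lin_sub_def matrix_vector_mult_line_nth)

text \<open>Boundedness of the feasible set forces the ray to leave it, so there is a last feasible
  parameter \<open>t\<close>. If no constraint became active there, the inactive ones would stay
  strict slightly beyond \<open>t\<close>, while the active ones are constant along
  \<open>p\<close>; this contradicts the choice of \<open>t\<close>.\<close>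

lemma feasible_line_hits_new_constraint:
  assumes bdd: "bounded (feasible A b)" and x: "x \<in> feasible A b"
    and p: "p \<in> lin_sub A (active A b x)" "p \<noteq> 0"
  shows "\<exists>t\<ge>0. x + t *\<^sub>R p \<in> feasible A b \<and> active A b x \<subset> active A b (x + t *\<^sub>R p)"
proof -
  define T where "T = {0..} \<inter> {t. x + t *\<^sub>R p \<in> feasible A b}"
  have "closed T"
    unfolding T_def feasible_iff
    by (intro closed_Int closed_atLeast closed_Collect_all closed_Collect_le continuous_intros)
  moreover have "bounded T"
  proof -
    obtain B where B: "\<And>y. y \<in> feasible A b \<Longrightarrow> norm y \<le> B"
      using bdd by (auto simp: bounded_iff)
    \<comment> \<open>Write \<open>t *\<^sub>R p\<close> as the feasible point minus
      \<open>x\<close> and divide by \<open>norm p\<close>, which is nonzero.\<close>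
    have "\<bar>t\<bar> \<le> (B + norm x) / norm p" if "t \<in> T" for t
    proof -
      have "norm (t *\<^sub>R p) \<le> norm (x + t *\<^sub>R p) + norm x"
        using norm_triangle_ineq4[of "x + t *\<^sub>R p" x] by simp
      also have "\<dots> \<le> B + norm x"
        using that B by (simp add: T_def)
      finally show ?thesis
        using p(2) by (simp add: field_simps)
    qed
    then show ?thesis
      by (auto simp: bounded_iff)
  qed
  moreover have "0 \<in> T"
    using x by (simp add: T_def)
  ultimately obtain t where t: "t \<in> T" and max: "\<And>s. s \<in> T \<Longrightarrow> s \<le> t"
    using compact_attains_sup[of T] by (auto simp: compact_eq_bounded_closed)
  have "active A b (x + t *\<^sub>R p) \<noteq> active A b x"
  proof
    assume same: "active A b (x + t *\<^sub>R p) = active A b x"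
    \<comment> \<open>Openness needs the intersection to be finite, which the finite index type
      guarantees.\<close>
    let ?U = "\<Inter>i\<in>- active A b x. {s. (A *v (x + s *\<^sub>R p)) $ i < b $ i}"
    have "open ?U"
      by (intro open_INT finite ballI open_Collect_less continuous_intros)
    moreover have "t \<in> ?U"
    proof (intro INT_I CollectI)
      fix i assume "i \<in> - active A b x"
      then have "(A *v (x + t *\<^sub>R p)) $ i \<noteq> b $ i"
        using same by (auto simp: active_def)
      moreover have "(A *v (x + t *\<^sub>R p)) $ i \<le> b $ i"
        using t by (simp add: T_def feasible_iff)
      ultimately show "(A *v (x + t *\<^sub>R p)) $ i < b $ i"
        by simp
    qed
    ultimately obtain e where "e > 0" and e: "\<And>s. dist s t < e \<Longrightarrow> s \<in> ?U"
      unfolding open_dist by meson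
    define s where "s = t + e / 2"
    have "s \<in> ?U"
      using \<open>e > 0\<close> by (intro e) (simp add: s_def dist_real_def)
    then have "(A *v (x + s *\<^sub>R p)) $ i \<le> b $ i" for i
      using active_mono_along_line[OF p(1), of s]
      by (cases "i \<in> active A b x") (auto simp: active_def intro: less_imp_le)
    then have "s \<in> T"
      using t \<open>e > 0\<close> by (simp add: T_def s_def feasible_iff)
    then show False
      using max \<open>e > 0\<close> by (force simp: s_def)
  qed
  then show ?thesis
    using t active_mono_along_line[OF p(1), of t] by (auto simp: T_def)
qed

lemma descent_points_nonempty:
  assumes "bounded (feasible A b)" "x \<in> feasible A b"
    and "\<not> positive_definite_on Q (lin_sub A (active A b x))"
  shows "descent_points Q d A b x \<noteq> {}"
proof -
  \<comment> \<open>This is the linear coefficient in \<open>Phi_along_line\<close>. It is odd in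
    \<open>p\<close> while the quadratic coefficient is even, so a sign change makes both
    nonpositive.\<close>
  define g where "g p = x \<bullet> (Q *v p) + p \<bullet> (Q *v x) + 2 * (d \<bullet> p)" for p
  obtain q where q: "q \<in> lin_sub A (active A b x)" "q \<noteq> 0" "q \<bullet> (Q *v q) \<le> 0"
    using assms(3) by (auto simp: positive_definite_on_def not_less)
  have neg: "Q *v (- q) = - (Q *v q)"
    using matrix_vector_mult_scaleR[of Q "-1" q] by simp
  have "g (- q) = - g q"
    by (simp add: g_def neg)
  define p where "p = (if g q \<le> 0 then q else - q)"
  have p: "p \<in> lin_sub A (active A b x)" "p \<noteq> 0" "p \<bullet> (Q *v p) \<le> 0" "g p \<le> 0"
    using q \<open>g (- q) = - g q\<close> by (auto simp: p_def neg lin_sub_uminus)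
  obtain t where t: "t \<ge> 0" "x + t *\<^sub>R p \<in> feasible A b"
      "active A b x \<subset> active A b (x + t *\<^sub>R p)"
    using feasible_line_hits_new_constraint[OF assms(1,2) p(1,2)] by blast
  have "Phi Q d (x + t *\<^sub>R p) \<le> Phi Q d x"
    using mult_nonneg_nonpos[OF t(1) p(4)] mult_nonneg_nonpos[OF zero_le_power2[of t] p(3)]
    by (simp add: Phi_along_line g_def)
  then show ?thesis
    using t by (auto simp: descent_points_def)
qed

text \<open>Keeps the termination claim from being vacuous: a pass without an admissible choice
  could not be extended to any sequence satisfying \<open>is_run\<close>.\<close>

lemma never_stuck_feasible:
  assumes "bounded (feasible A b)" "x \<in> feasible A b"
  shows "never_stuck Q M N d A b x"
  using face_minimizers_nonempty[OF assms] climbing_points_nonempty[OF assms]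
    descent_points_nonempty[OF assms]
  by (simp add: never_stuck_def)

section \<open>Termination\<close>

lemma iteration_Continue_feasible:
  "iteration Q M N d A b x (Continue y) \<Longrightarrow> y \<in> feasible A b"
  by (auto elim!: iteration.cases
      simp: climbing_points_def descent_points_def is_arg_min_def)

lemma reachable_feasible:
  assumes "reachable Q M N d A b x0 x" "x0 \<in> feasible A b"
  shows "x \<in> feasible A b"
  using assms unfolding reachable_def
  by (induction rule: rtranclp_induct) (auto dest: iteration_Continue_feasible)

text \<open>In a climbing step the failed stopping test puts \<open>y\<close> strictly below
  \<open>xt\<close>, which already minimizes \<open>Phi\<close> over the face of
  \<open>x\<close>.\<close>

lemma iteration_Continue_cases:
  assumes "iteration Q M N d A b x (Continue y)"
  obtains
    (below_face) "\<And>z. z \<in> feasible A b \<inter> aff_sub A b (active A b x) \<Longrightarrow> Phi Q d y < Phi Q d z"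
  | (more_active) "Phi Q d y \<le> Phi Q d x" "active A b x \<subset> active A b y"
  using assms
proof cases
  case (climb xt)
  have "Phi Q d y < Phi Q d z" if "z \<in> feasible A b \<inter> aff_sub A b (active A b x)" for z
    using climb that by (fastforce simp: face_minimizers_def is_arg_min_linorder)
  then show ?thesis by (rule below_face)
next
  case descend
  then show ?thesis by (intro more_active) (auto simp: descent_points_def)
qed

lemma no_infinite_iteration:
  fixes A :: "real^'n^'m"
  assumes start: "x 0 \<in> feasible A b"
    and step: "\<And>k. iteration Q M N d A b (x k) (Continue (x (Suc k)))"
  shows False
proof -
  define face where "face k = feasible A b \<inter> aff_sub A b (active A b (x k))" for k
  \<comment> \<open>Membership is decided by the inequality, not by the rule applied:
    \<open>C\<close> contains every climbing step, and any step outside it enlarges the active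
    set.\<close>
  define C where "C = {k. \<forall>z\<in>face k. Phi Q d (x (Suc k)) < Phi Q d z}"
  have feas: "x k \<in> feasible A b" for k
    using start step by (cases k) (auto dest: iteration_Continue_feasible)
  then have self: "x k \<in> face k" for k
    by (simp add: face_def self_in_aff_sub_active)
  have grow: "Phi Q d (x (Suc k)) \<le> Phi Q d (x k) \<and> active A b (x k) \<subset> active A b (x (Suc k))"
    if "k \<notin> C" for k
    using step[of k] that by (cases rule: iteration_Continue_cases) (auto simp: C_def face_def)
  \<comment> \<open>For \<open>k\<close> in \<open>C\<close>, compare with \<open>x k\<close>
    itself, a point of its own face.\<close>
  have "Phi Q d (x (Suc k)) \<le> Phi Q d (x k)" for k
    using grow[of k] self[of k] by (cases "k \<in> C") (auto simp: C_def intro: less_imp_le)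
  then have anti: "j \<le> k \<Longrightarrow> Phi Q d (x k) \<le> Phi Q d (x j)" for j k
    using lift_Suc_antimono_le[of "\<lambda>k. Phi Q d (x k)"] by blast
  have distinct: "active A b (x j) \<noteq> active A b (x k)" if "j \<in> C" "j < k" for j k
  proof
    assume "active A b (x j) = active A b (x k)"
    then have "x k \<in> face j"
      using self[of k] by (simp add: face_def)
    then have "Phi Q d (x (Suc j)) < Phi Q d (x k)"
      using \<open>j \<in> C\<close> by (simp add: C_def)
    then show False
      using anti[of "Suc j" k] \<open>j < k\<close> by simp
  qed
  \<comment> \<open>Active sets are subsets of a finite type, so injectivity makes \<open>C\<close>
    finite.\<close>
  have "inj_on (\<lambda>k. active A b (x k)) C"
    by (rule linorder_inj_onI) (use distinct in auto)
  then have "finite C"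
    using finite_imageD[OF finite] by blast
  then obtain K where K: "\<And>k. k \<in> C \<Longrightarrow> k < K"
    unfolding finite_nat_set_iff_bounded by blast
  \<comment> \<open>From \<open>K\<close> on every step gains an active index;
    \<open>CARD('m) + 1\<close> such steps are too many.\<close>
  have "n \<le> card (active A b (x (K + n)))" for n
  proof (induction n)
    case (Suc n)
    have "K + n \<notin> C"
      using K by force
    then have "card (active A b (x (K + n))) < card (active A b (x (K + Suc n)))"
      using grow[of "K + n"] by (simp add: psubset_card_mono)
    then show ?case
      using Suc by simp
  qed simp
  from this[of "Suc CARD('m)"] show False
    using card_mono[OF finite[of UNIV] subset_UNIV, of "active A b (x (K + Suc CARD('m)))"] by simp
qed

lemma run_stops:
  assumes "is_run Q M N d A b x0 r" "x0 \<in> feasible A b"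
  shows "\<exists>k y. r k = Stop y"
proof (rule ccontr)
  assume "\<nexists>k y. r k = Stop y"
  then have "\<forall>k. \<exists>x. r k = Continue x"
    by (metis outcome.exhaust)
  then obtain x where x: "\<And>k. r k = Continue (x k)"
    by metis
  have "x 0 \<in> feasible A b"
    using assms x[of 0] by (simp add: is_run_def)
  moreover have "iteration Q M N d A b (x k) (Continue (x (Suc k)))" for k
    using assms(1) by (simp add: is_run_def x)
  ultimately show False
    by (rule no_infinite_iteration)
qed

theorem theorem3:
  fixes Q M N :: "real^'n^'n" and d x0 :: "real^'n"
    and A :: "real^'n^'m" and b :: "real^'m"
  assumes "transpose Q = Q"
    and "\<exists>l<0. eigenvalue Q l"
    and "bounded (feasible A b)"
    and "symmetric_psd M" and "symmetric_psd N" and "Q = M - N"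
    and "x0 \<in> feasible A b"
  shows "(\<forall>x. reachable Q M N d A b x0 x \<longrightarrow> never_stuck Q M N d A b x) \<and>
         (\<forall>r. is_run Q M N d A b x0 r \<longrightarrow> (\<exists>k y. r k = Stop y))"
  using never_stuck_feasible[OF assms(3)] reachable_feasible[OF _ assms(7)]
    run_stops[OF _ assms(7)] by auto

end
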